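(* Let $K\ge1$ be an integer with $K\equiv \pm1\pmod 6$, and let $p_1^{a_1}\cdots p_r^{a_r}$ be the prime factorization of $K^2+4$. If $m>1$ is an integer with $\pi_K(m)=m$, then $m=24\cdot p_1^{j_1}\cdots p_r^{j_r}$ for some integers $j_1,\dots,j_r\ge0$.
   Context: The $K$-Fibonacci sequence is $F_{K,0}=0$, $F_{K,1}=1$, $F_{K,n}=K F_{K,n-1}+F_{K,n-2}$; for an integer $m>1$, $\pi_K(m)$ is the length of its shortest period modulo $m$. *)

theory Defs
  imports "HOL-Number_Theory.Number_Theory"
begin

fun kfib :: "int \<Rightarrow> nat \<Rightarrow> int" where
  "kfib K 0 = 0"
| "kfib K (Suc 0) = 1"
| "kfib K (Suc (Suc n)) = K * kfib K (Suc n) + kfib K n"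

(* The recurrence is invertible modulo m, so for m > 1 the sequence is purely
   periodic and the set of admissible t is nonempty. *)
definition kfib_period :: "int \<Rightarrow> int \<Rightarrow> nat" where
  "kfib_period K m = (LEAST t. t > 0 \<and> (\<forall>n. [kfib K (n + t) = kfib K n] (mod m)))"

end

theory Submission
  imports Defs
begin

text \<open>
  Let \<open>\<alpha>\<close> be a root of \<open>x\<^sup>2 = K x + 1\<close>. Then \<open>t\<close> is a period modulo \<open>m\<close> iff \<open>\<alpha> ^ t \<equiv> 1\<close> modulo
  \<open>m\<close> in \<open>\<int>[\<alpha>]\<close>. For an odd prime \<open>p\<close>, the Frobenius map applied to \<open>2 \<alpha> = K + \<surd>(K\<^sup>2 + 4)\<close> shows
  that \<open>4 p\<close> is a period modulo \<open>p\<close> if \<open>p\<close> divides \<open>K\<^sup>2 + 4\<close>, and that \<open>p\<^sup>2 - 1\<close> is one otherwise;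
  modulo 2, a period is 3.

  If \<open>t\<close> is a period modulo \<open>R\<close> and all primes dividing \<open>k\<close> divide \<open>R\<close>, then \<open>t k\<close> is a period modulo
  \<open>R k\<close>. Hence, if \<open>m\<close> equals its own period and \<open>R\<close> is a divisor of \<open>m\<close> with the same prime divisors,
  then \<open>R\<close> divides every period \<open>t\<close> modulo \<open>R\<close>. For the radical \<open>R\<close> of \<open>m\<close> this shows that all primes
  dividing \<open>m\<close> divide \<open>6 (K\<^sup>2 + 4)\<close>. With \<open>d\<close> the product of the primes that divide both \<open>m\<close> and
  \<open>K\<^sup>2 + 4\<close>, the choice \<open>R = gcd m 144 * d\<close>, \<open>t = 24 d\<close> shows that neither 16 nor 9 divides \<open>m\<close>.
  Conversely, \<open>m\<close> is even because the norm of \<open>\<alpha>\<close> is \<open>-1\<close>, so the least period 3 modulo 2 divides \<open>m\<close>,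
  and then so does the least period 8 modulo 3.
\<close>

section \<open>The ring \<int>[\<alpha>] inside the reals and its congruences\<close>

definition kfib_root :: "int \<Rightarrow> real" where
  "kfib_root K = (of_int K + sqrt (of_int (K\<^sup>2 + 4))) / 2"

text \<open>This is \<int>[\<alpha>]; as a set of reals it inherits ring identities and the binomial
  theorem from real arithmetic.\<close>

definition kfib_ring :: "int \<Rightarrow> real set" where
  "kfib_ring K = {of_int a + of_int b * kfib_root K | a b. True}"

definition ring_cong :: "int \<Rightarrow> int \<Rightarrow> real \<Rightarrow> real \<Rightarrow> bool" where
  "ring_cong K m x y \<longleftrightarrow> (\<exists>z\<in>kfib_ring K. x - y = of_int m * z)"

text \<open>Two consecutive values determine the sequence, so the indices 0 and 1 suffice. Since
  \<open>t = 0\<close> qualifies, periods are closed under remainders.\<close>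

definition is_kfib_period :: "int \<Rightarrow> int \<Rightarrow> nat \<Rightarrow> bool" where
  "is_kfib_period K m t \<longleftrightarrow> [kfib K t = 0] (mod m) \<and> [kfib K (Suc t) = 1] (mod m)"

lemma kfib_root_double: "2 * kfib_root K = of_int K + sqrt (of_int (K\<^sup>2 + 4))"
  by (simp add: kfib_root_def)

lemma kfib_root_square: "kfib_root K * kfib_root K = of_int K * kfib_root K + 1"
proof -
  have "sqrt (of_int (K\<^sup>2 + 4)) * sqrt (of_int (K\<^sup>2 + 4)) = of_int K * of_int K + 4"
    by (simp add: power2_eq_square)
  then show ?thesis
    unfolding kfib_root_def by (simp add: field_simps)
qed

lemma kfib_ring_of_int [simp, intro]: "of_int a \<in> kfib_ring K"
  unfolding kfib_ring_def by (rule CollectI, rule exI[of _ a], rule exI[of _ 0]) simp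

lemma kfib_ring_root [simp, intro]: "kfib_root K \<in> kfib_ring K"
  unfolding kfib_ring_def by (rule CollectI, rule exI[of _ 0], rule exI[of _ 1]) simp

lemma kfib_ring_add [intro]: "x \<in> kfib_ring K \<Longrightarrow> y \<in> kfib_ring K \<Longrightarrow> x + y \<in> kfib_ring K"
proof -
  assume "x \<in> kfib_ring K" "y \<in> kfib_ring K"
  then obtain a b c d where
    "x = of_int a + of_int b * kfib_root K" "y = of_int c + of_int d * kfib_root K"
    unfolding kfib_ring_def by blast
  then have "x + y = of_int (a + c) + of_int (b + d) * kfib_root K"
    by (simp add: algebra_simps)
  then show ?thesis
    unfolding kfib_ring_def by blast
qed

lemma kfib_ring_mult [intro]: "x \<in> kfib_ring K \<Longrightarrow> y \<in> kfib_ring K \<Longrightarrow> x * y \<in> kfib_ring K"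
proof -
  assume "x \<in> kfib_ring K" "y \<in> kfib_ring K"
  then obtain a b c d where
    "x = of_int a + of_int b * kfib_root K" "y = of_int c + of_int d * kfib_root K"
    unfolding kfib_ring_def by blast
  then have "x * y = of_int (a * c) + of_int (a * d + b * c) * kfib_root K
      + of_int (b * d) * (kfib_root K * kfib_root K)"
    by (simp add: algebra_simps)
  then have "x * y = of_int (a * c + b * d) + of_int (a * d + b * c + b * d * K) * kfib_root K"
    unfolding kfib_root_square by (simp add: algebra_simps)
  then show ?thesis
    unfolding kfib_ring_def by blast
qed

lemma kfib_ring_one [simp, intro]: "1 \<in> kfib_ring K"
  using kfib_ring_of_int[of 1] by simp

lemma kfib_ring_zero [simp, intro]: "0 \<in> kfib_ring K"
  using kfib_ring_of_int[of 0] by simp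

lemma kfib_ring_of_nat [simp, intro]: "of_nat n \<in> kfib_ring K"
  using kfib_ring_of_int[of "int n"] by simp

lemma kfib_ring_numeral [simp, intro]: "numeral n \<in> kfib_ring K"
  using kfib_ring_of_int[of "numeral n"] by simp

lemma kfib_ring_uminus [intro]: "x \<in> kfib_ring K \<Longrightarrow> - x \<in> kfib_ring K"
  using kfib_ring_mult[OF kfib_ring_of_int[of "-1"]] by simp

lemma kfib_ring_diff [intro]: "x \<in> kfib_ring K \<Longrightarrow> y \<in> kfib_ring K \<Longrightarrow> x - y \<in> kfib_ring K"
  using kfib_ring_add[OF _ kfib_ring_uminus] by fastforce

lemma kfib_ring_power [intro]: "x \<in> kfib_ring K \<Longrightarrow> x ^ n \<in> kfib_ring K"
  by (induction n) auto

lemma kfib_ring_sum: "(\<And>i. i \<in> A \<Longrightarrow> f i \<in> kfib_ring K) \<Longrightarrow> sum f A \<in> kfib_ring K"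
  by (induction A rule: infinite_finite_induct) auto

lemma kfib_ring_sqrt [intro]: "sqrt (of_int (K\<^sup>2 + 4)) \<in> kfib_ring K"
proof -
  have "sqrt (of_int (K\<^sup>2 + 4)) = of_int 2 * kfib_root K - of_int K"
    using kfib_root_double[of K] by simp
  then show ?thesis
    by (metis kfib_ring_diff kfib_ring_mult kfib_ring_of_int kfib_ring_root)
qed

lemma ring_congI: "z \<in> kfib_ring K \<Longrightarrow> x - y = of_int m * z \<Longrightarrow> ring_cong K m x y"
  unfolding ring_cong_def by blast

lemma ring_congE:
  assumes "ring_cong K m x y"
  obtains z where "z \<in> kfib_ring K" "x = y + of_int m * z"
  using assms unfolding ring_cong_def by (metis add.commute diff_add_cancel)

lemma ring_cong_refl [simp]: "ring_cong K m x x"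
  by (rule ring_congI[of 0]) auto

lemma ring_cong_sym: "ring_cong K m x y \<Longrightarrow> ring_cong K m y x"
  by (erule ring_congE, rule ring_congI[OF kfib_ring_uminus]) auto

lemma ring_cong_add:
  assumes "ring_cong K m x y" "ring_cong K m x' y'"
  shows "ring_cong K m (x + x') (y + y')"
proof -
  obtain z z' where "z \<in> kfib_ring K" "x = y + of_int m * z"
    and "z' \<in> kfib_ring K" "x' = y' + of_int m * z'"
    using assms by (meson ring_congE)
  then show ?thesis
    by (intro ring_congI[of "z + z'"]) (auto simp: algebra_simps)
qed

lemma ring_cong_trans [trans]:
  assumes "ring_cong K m x y" "ring_cong K m y z"
  shows "ring_cong K m x z"
  using ring_cong_add[OF assms] by (simp add: ring_cong_def)

lemma ring_cong_scale:
  assumes "c \<in> kfib_ring K" "ring_cong K m x y"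
  shows "ring_cong K m (c * x) (c * y)"
  using assms(2) by (rule ring_congE)
    (rule ring_congI[OF kfib_ring_mult[OF assms(1)]], auto simp: algebra_simps)

lemma ring_cong_mult:
  assumes "x \<in> kfib_ring K" "y' \<in> kfib_ring K" "ring_cong K m x y" "ring_cong K m x' y'"
  shows "ring_cong K m (x * x') (y * y')"
proof -
  have "ring_cong K m (x * x') (x * y')"
    using assms by (intro ring_cong_scale)
  also have "ring_cong K m (x * y') (y * y')"
    using ring_cong_scale[OF assms(2,3)] by (simp add: mult.commute)
  finally show ?thesis .
qed

lemma ring_cong_power:
  assumes "x \<in> kfib_ring K" "y \<in> kfib_ring K" "ring_cong K m x y"
  shows "ring_cong K m (x ^ n) (y ^ n)"
  by (induction n) (auto intro!: ring_cong_mult assms)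

lemma ring_cong_of_int:
  assumes "[a = b] (mod m)"
  shows "ring_cong K m (of_int a) (of_int b)"
proof -
  obtain k where "a - b = m * k"
    using assms by (meson cong_iff_dvd_diff dvdE)
  then have "of_int a - of_int b = real_of_int m * of_int k"
    by (metis of_int_diff of_int_mult)
  then show ?thesis
    by (rule ring_congI[OF kfib_ring_of_int])
qed

text \<open>The inverse of \<open>c\<close> modulo \<open>m\<close> is an integer, hence lies in the
  ring. This removes the factors 2 and 4 that come from working with 2 \<alpha>.\<close>

lemma ring_cong_cancel:
  assumes "coprime c m" "x \<in> kfib_ring K" "y \<in> kfib_ring K"
    and "ring_cong K m (of_int c * x) (of_int c * y)"
  shows "ring_cong K m x y"
proof -
  obtain d where d: "[c * d = 1] (mod m)"
    using assms(1) coprime_iff_invertible_int by blast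
  have unit: "ring_cong K m (of_int (c * d)) 1"
    using ring_cong_of_int[OF d] by simp
  have "ring_cong K m x (of_int (c * d) * x)"
    using ring_cong_scale[OF assms(2) ring_cong_sym[OF unit]] by (simp add: mult_ac)
  also have "ring_cong K m (of_int (c * d) * x) (of_int (c * d) * y)"
    using ring_cong_scale[OF kfib_ring_of_int[of d] assms(4)] by (simp add: mult_ac)
  also have "ring_cong K m (of_int (c * d) * y) y"
    using ring_cong_scale[OF assms(3) unit] by (simp add: mult_ac)
  finally show ?thesis .
qed

section \<open>Frobenius and Fermat modulo a prime\<close>

text \<open>The inner binomial coefficients are divisible by \<open>p\<close>; their quotients by
  \<open>p\<close> give an explicit witness in the ring.\<close>

lemma kfib_ring_frobenius:
  assumes "prime p" "x \<in> kfib_ring K" "y \<in> kfib_ring K"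
  shows "ring_cong K (int p) ((x + y) ^ p) (x ^ p + y ^ p)"
proof (rule ring_congI)
  let ?f = "\<lambda>k. of_nat ((p choose k) div p) * x ^ k * y ^ (p - k)"
  show "(\<Sum>k\<in>{1..<p}. ?f k) \<in> kfib_ring K"
    using assms by (intro kfib_ring_sum kfib_ring_mult kfib_ring_power kfib_ring_of_nat)
  have "p > 1"
    using assms(1) prime_gt_1_nat by blast
  then have split: "{..p} = insert 0 (insert p {1..<p})"
    by auto
  have "of_nat (p choose k) * x ^ k * y ^ (p - k) = of_int (int p) * ?f k" if "k \<in> {1..<p}" for k
  proof -
    have "p dvd (p choose k)"
      using that assms(1) by (intro dvd_choose_prime) auto
    then have "real (p choose k) = real p * real ((p choose k) div p)"
      by (metis dvd_mult_div_cancel of_nat_mult)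
    then show ?thesis
      by simp
  qed
  then have "(\<Sum>k\<in>{1..<p}. of_nat (p choose k) * x ^ k * y ^ (p - k))
      = of_int (int p) * (\<Sum>k\<in>{1..<p}. ?f k)"
    unfolding sum_distrib_left by (rule sum.cong[OF refl])
  then show "(x + y) ^ p - (x ^ p + y ^ p) = of_int (int p) * (\<Sum>k\<in>{1..<p}. ?f k)"
    using \<open>p > 1\<close> unfolding binomial_ring split by simp
qed

lemma fermat_theorem_int:
  assumes "prime p" "\<not> int p dvd a"
  shows "[a ^ (p - 1) = 1] (mod int p)"
proof -
  define b where "b = nat (a mod int p)"
  have b: "int b = a mod int p"
    using prime_gt_0_nat[OF assms(1)] by (simp add: b_def)
  then have "\<not> p dvd b"
    using assms(2) by (metis dvd_mod_iff dvd_refl int_dvd_int_iff)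
  then have "[b ^ (p - 1) = 1] (mod p)"
    using fermat_theorem assms(1) by blast
  then have "[int b ^ (p - 1) = 1] (mod int p)"
    by (metis cong_int_iff of_nat_1 of_nat_power)
  moreover have "[a ^ (p - 1) = int b ^ (p - 1)] (mod int p)"
    unfolding b by (intro cong_pow) (simp add: cong_def)
  ultimately show ?thesis
    using cong_trans by blast
qed

lemma fermat_int:
  assumes "prime p"
  shows "[a ^ p = a] (mod int p)"
proof (cases "int p dvd a")
  case True
  then have "int p dvd a ^ p"
    using prime_gt_0_nat[OF assms] by (meson dvd_power dvd_trans)
  with True show ?thesis
    by (simp add: cong_iff_dvd_diff)
next
  case False
  then have "[a * a ^ (p - 1) = a * 1] (mod int p)"
    using assms by (intro cong_scalar_left fermat_theorem_int)
  then show ?thesis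
    using prime_gt_0_nat[OF assms] by (simp add: power_eq_if)
qed

text \<open>Frobenius is additive and fixes integers by Fermat, while \<open>s ^ p\<close> is
  \<open>s\<close> times a power of \<open>s * s = K\<^sup>2 + 4\<close>.\<close>

lemma kfib_ring_frobenius_sqrt:
  fixes K a b :: int
  assumes "prime p" "odd p"
  defines "s \<equiv> sqrt (of_int (K\<^sup>2 + 4))"
  shows "ring_cong K (int p) ((of_int a + of_int b * s) ^ p)
    (of_int a + of_int (b * (K\<^sup>2 + 4) ^ (p div 2)) * s)"
proof -
  have s: "s \<in> kfib_ring K" "s * s = of_int (K\<^sup>2 + 4)"
    unfolding s_def by (auto simp del: of_int_add)
  have "s ^ p = s ^ Suc (2 * (p div 2))"
    using \<open>odd p\<close> by (simp add: odd_two_times_div_two_succ)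
  also have "\<dots> = of_int ((K\<^sup>2 + 4) ^ (p div 2)) * s"
    using s(2) by (simp add: power_mult power2_eq_square del: of_int_add)
  finally have sp: "s ^ p = of_int ((K\<^sup>2 + 4) ^ (p div 2)) * s" .
  have "ring_cong K (int p) ((of_int a + of_int b * s) ^ p) (of_int (a ^ p) + of_int (b ^ p) * s ^ p)"
    using kfib_ring_frobenius[OF assms(1), of "of_int a" K "of_int b * s"] s(1)
    by (auto simp: power_mult_distrib)
  also have "ring_cong K (int p) (of_int (a ^ p) + of_int (b ^ p) * s ^ p) (of_int a + of_int b * s ^ p)"
    using s(1) by (intro ring_cong_add ring_cong_mult ring_cong_of_int fermat_int assms) auto
  finally show ?thesis
    unfolding sp by (simp add: mult_ac)
qed

section \<open>Periods as exponents of \<alpha>\<close>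

text \<open>This is F_n \<alpha> + F_(n-1), with F_(n-1) replaced by F_(n+1) - K F_n so that
  \<open>n = 0\<close> needs no negative index.\<close>

lemma kfib_root_power:
  "kfib_root K ^ n = of_int (kfib K (Suc n)) + of_int (kfib K n) * (kfib_root K - of_int K)"
proof (induction n)
  case (Suc n)
  have "kfib_root K ^ Suc n = of_int (kfib K (Suc n)) * kfib_root K
      + of_int (kfib K n) * (kfib_root K * kfib_root K - of_int K * kfib_root K)"
    by (simp add: Suc algebra_simps)
  also have "\<dots> = of_int (kfib K (Suc (Suc n))) + of_int (kfib K (Suc n)) * (kfib_root K - of_int K)"
    by (simp add: kfib_root_square algebra_simps)
  finally show ?case .
qed simp

text \<open>The square would lie strictly between those of \<open>K\<close> and
  \<open>K + 2\<close>, so it would be that of \<open>K + 1\<close>, which gives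
  \<open>2 * K = 3\<close>.\<close>

lemma not_square_square_plus_4:
  fixes K c :: int
  assumes "K \<ge> 1"
  shows "K\<^sup>2 + 4 \<noteq> c\<^sup>2"
proof
  assume eq: "K\<^sup>2 + 4 = c\<^sup>2"
  have "K\<^sup>2 < \<bar>c\<bar>\<^sup>2" "\<bar>c\<bar>\<^sup>2 < (K + 2)\<^sup>2"
    using eq assms by (auto simp: power2_eq_square algebra_simps)
  then have "K < \<bar>c\<bar>" "\<bar>c\<bar> < K + 2"
    using assms by (auto intro: power2_less_imp_less)
  then have "\<bar>c\<bar> = K + 1"
    by simp
  then have "K\<^sup>2 + 4 = (K + 1)\<^sup>2"
    using eq by (metis power2_abs)
  then have "2 * K = 3"
    by (simp add: power2_eq_square algebra_simps)
  then show False
    by presburger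
qed

text \<open>If \<open>b \<noteq> 0\<close>, isolating the square root and squaring shows that
  \<open>b\<close> divides \<open>2 * a + b * K\<close>, so \<open>K\<^sup>2 + 4\<close> would be a
  perfect square.\<close>

lemma kfib_root_lin_indep:
  assumes "K \<ge> 1" "of_int a + of_int b * kfib_root K = 0"
  shows "a = 0 \<and> b = 0"
proof (cases "b = 0")
  case False
  have "of_int b * sqrt (of_int (K\<^sup>2 + 4)) = - of_int (2 * a + b * K)"
    using assms(2) by (simp add: kfib_root_def field_simps)
  then have "(of_int b * sqrt (of_int (K\<^sup>2 + 4)))\<^sup>2 = (- of_int (2 * a + b * K))\<^sup>2"
    by simp
  then have "of_int (b\<^sup>2 * (K\<^sup>2 + 4)) = real_of_int ((2 * a + b * K)\<^sup>2)"
    by (simp add: power_mult_distrib del: of_int_add)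
  then have eq: "b\<^sup>2 * (K\<^sup>2 + 4) = (2 * a + b * K)\<^sup>2"
    by (simp only: of_int_eq_iff)
  then have "b\<^sup>2 dvd (2 * a + b * K)\<^sup>2"
    by (metis dvd_triv_left)
  then have "b dvd 2 * a + b * K"
    by simp
  then obtain c where "2 * a + b * K = b * c"
    by blast
  then have "K\<^sup>2 + 4 = c\<^sup>2"
    using eq False by (simp add: power_mult_distrib)
  then show ?thesis
    using not_square_square_plus_4[OF assms(1)] by blast
qed (use assms in simp)

text \<open>Congruent coefficients give congruent ring elements; the converse compares coefficients
  by the linear independence of 1 and \<alpha>.\<close>

lemma is_kfib_period_iff_root:
  assumes "K \<ge> 1"
  shows "is_kfib_period K m t \<longleftrightarrow> ring_cong K m (kfib_root K ^ t) 1"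
proof
  assume "is_kfib_period K m t"
  then have "ring_cong K m (of_int (kfib K (Suc t)) + of_int (kfib K t) * (kfib_root K - of_int K))
      (of_int 1 + of_int 0 * (kfib_root K - of_int K))"
    unfolding is_kfib_period_def
    by (intro ring_cong_add ring_cong_mult ring_cong_of_int kfib_ring_diff) auto
  then show "ring_cong K m (kfib_root K ^ t) 1"
    unfolding kfib_root_power by simp
next
  assume "ring_cong K m (kfib_root K ^ t) 1"
  then obtain z where z: "z \<in> kfib_ring K" "kfib_root K ^ t = 1 + of_int m * z"
    by (rule ring_congE)
  then obtain a b where ab: "z = of_int a + of_int b * kfib_root K"
    unfolding kfib_ring_def by blast
  have "of_int (kfib K (Suc t) - K * kfib K t - 1 - m * a) + of_int (kfib K t - m * b) * kfib_root K = 0"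
    using z(2) unfolding kfib_root_power ab by (simp add: algebra_simps)
  then have "kfib K (Suc t) - K * kfib K t - 1 - m * a = 0 \<and> kfib K t - m * b = 0"
    by (rule kfib_root_lin_indep[OF assms])
  then have "kfib K t = m * b" "kfib K (Suc t) - 1 = m * (a + K * b)"
    by (auto simp: algebra_simps)
  then show "is_kfib_period K m t"
    unfolding is_kfib_period_def cong_iff_dvd_diff by simp
qed

text \<open>Links the two-value test to the condition in \<open>kfib_period\<close>, by induction on
  pairs of consecutive indices.\<close>

lemma is_kfib_period_iff_shift:
  "is_kfib_period K m t \<longleftrightarrow> (\<forall>n. [kfib K (n + t) = kfib K n] (mod m))"
proof
  assume per: "is_kfib_period K m t"
  have "[kfib K (n + t) = kfib K n] (mod m) \<and> [kfib K (Suc n + t) = kfib K (Suc n)] (mod m)" for n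
  proof (induction n)
    case 0
    then show ?case
      using per by (simp add: is_kfib_period_def)
  next
    case (Suc n)
    then show ?case
      by (auto intro!: cong_add cong_scalar_left)
  qed
  then show "\<forall>n. [kfib K (n + t) = kfib K n] (mod m)"
    by blast
next
  assume "\<forall>n. [kfib K (n + t) = kfib K n] (mod m)"
  from this[rule_format, of 0] this[rule_format, of 1] show "is_kfib_period K m t"
    by (simp add: is_kfib_period_def)
qed

section \<open>Divisibility and lifting of periods\<close>

lemma is_kfib_period_mult:
  assumes "K \<ge> 1" "is_kfib_period K m t"
  shows "is_kfib_period K m (t * k)"
  using assms ring_cong_power[of "kfib_root K ^ t" K 1 m k]
  by (auto simp: is_kfib_period_iff_root power_mult)

lemma is_kfib_period_dvd:
  assumes "K \<ge> 1" "is_kfib_period K m t" "t dvd u"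
  shows "is_kfib_period K m u"
  using assms is_kfib_period_mult by (auto elim!: dvdE)

lemma is_kfib_period_dvd_modulus:
  assumes "is_kfib_period K m t" "n dvd m"
  shows "is_kfib_period K n t"
  using assms unfolding is_kfib_period_def by (meson cong_dvd_modulus)

lemma is_kfib_period_mod:
  assumes "K \<ge> 1" "is_kfib_period K m t" "is_kfib_period K m u"
  shows "is_kfib_period K m (u mod t)"
  unfolding is_kfib_period_iff_shift
proof
  fix n
  have "[kfib K (n + u mod t + t * (u div t)) = kfib K (n + u mod t)] (mod m)"
    using is_kfib_period_mult[OF assms(1,2)] unfolding is_kfib_period_iff_shift by blast
  moreover have "n + u mod t + t * (u div t) = n + u"
    by simp
  moreover have "[kfib K (n + u) = kfib K n] (mod m)"
    using assms(3) unfolding is_kfib_period_iff_shift by blast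
  ultimately show "[kfib K (n + u mod t) = kfib K n] (mod m)"
    by (metis cong_sym cong_trans)
qed

text \<open>Otherwise the remainder of \<open>t\<close> would be a smaller positive period.\<close>

lemma kfib_period_dvd:
  assumes "K \<ge> 1" "is_kfib_period K m t" "kfib_period K m > 0" "is_kfib_period K m (kfib_period K m)"
  shows "kfib_period K m dvd t"
proof (rule ccontr)
  assume "\<not> kfib_period K m dvd t"
  then have pos: "t mod kfib_period K m > 0"
    by (simp add: mod_greater_zero_iff_not_dvd)
  have "is_kfib_period K m (t mod kfib_period K m)"
    using assms by (intro is_kfib_period_mod)
  then have "kfib_period K m \<le> t mod kfib_period K m"
    unfolding kfib_period_def is_kfib_period_iff_shift
    using pos by (intro Least_le) (auto simp: kfib_period_def)
  then show False
    using mod_less_divisor[OF assms(3)] by (meson leD)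
qed

text \<open>
  If \<open>x = 1 + m z\<close>, then \<open>x ^ p - 1 = (x - 1) (1 + x + \<dots> + x ^ (p - 1))\<close>, where the second factor
  vanishes modulo \<open>p\<close> because \<open>p\<close> divides \<open>m\<close>.
\<close>

lemma is_kfib_period_lift:
  assumes "K \<ge> 1" "is_kfib_period K m t" "int p dvd m"
  shows "is_kfib_period K (int p * m) (p * t)"
proof -
  define x where "x = kfib_root K ^ t"
  have x: "x \<in> kfib_ring K"
    unfolding x_def by blast
  have x1: "ring_cong K m x 1"
    using assms by (simp add: is_kfib_period_iff_root x_def)
  obtain z where z: "z \<in> kfib_ring K" "x = 1 + of_int m * z"
    using x1 by (rule ring_congE)
  define s where "s = (\<Sum>i<p. x ^ i)"
  have "ring_cong K (int p) x 1"
  proof -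
    obtain c where "m = int p * c" using assms(3) by blast
    then show ?thesis
      using z by (intro ring_congI[of "of_int c * z"]) auto
  qed
  then have "ring_cong K (int p) (x ^ i) 1" for i
    using ring_cong_power[OF x kfib_ring_one] by fastforce
  then have "ring_cong K (int p) (\<Sum>i<n. x ^ i) (of_nat n)" for n
    by (induction n) (auto intro: ring_cong_add simp: add.commute[of 1])
  then obtain w where w: "w \<in> kfib_ring K" "s = of_nat p + of_int (int p) * w"
    unfolding s_def by (metis ring_congE)
  have "x ^ p - 1 = (x - 1) * s"
    unfolding s_def by (rule power_diff_1_eq)
  also have "\<dots> = of_int (int p * m) * (z * (1 + w))"
    unfolding w(2) using z(2) by (simp add: algebra_simps)
  finally have "ring_cong K (int p * m) (x ^ p) 1"
    using z(1) w(1) by (intro ring_congI[of "z * (1 + w)"]) auto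
  then show ?thesis
    using assms(1) by (simp add: is_kfib_period_iff_root x_def mult.commute[of p] flip: power_mult)
qed

section \<open>Periods modulo a prime\<close>

text \<open>Applying Frobenius twice multiplies the square root by
  \<open>(K\<^sup>2 + 4) ^ (p - 1)\<close>, which is 1 modulo \<open>p\<close> by Fermat. Hence
  \<alpha> ^ (p^2) \<equiv> \<alpha>, and \<alpha> is a unit.\<close>

lemma is_kfib_period_square_minus_1:
  assumes "K \<ge> 1" "prime p" "odd p" "\<not> int p dvd K\<^sup>2 + 4"
  shows "is_kfib_period K (int p) (p\<^sup>2 - 1)"
proof -
  let ?\<alpha> = "kfib_root K"
  define e where "e = (K\<^sup>2 + 4) ^ (p div 2)"
  define s where "s = sqrt (of_int (K\<^sup>2 + 4))"
  have s: "s \<in> kfib_ring K"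
    unfolding s_def by blast
  have a2: "of_int K + of_int 1 * s = 2 * ?\<alpha>"
    by (simp add: kfib_root_def s_def)
  have frob: "ring_cong K (int p) ((of_int a + of_int b * s) ^ p) (of_int a + of_int (b * e) * s)" for a b
    unfolding s_def e_def by (rule kfib_ring_frobenius_sqrt) fact+
  have "e * e = (K\<^sup>2 + 4) ^ (p - 1)"
    unfolding e_def power_add[symmetric] using \<open>odd p\<close> by (auto elim!: oddE simp: mult_2)
  then have ee: "[e * e = 1] (mod int p)"
    using fermat_theorem_int[OF assms(2,4)] by simp
  \<comment> \<open>Fermat twice; this turns \<open>2 * \<alpha> ^ p\<^sup>2\<close> into a power of
    2 \<alpha>, on which Frobenius can act.\<close>
  have two: "[2 ^ p\<^sup>2 = 2] (mod int p)"
    using cong_trans[OF cong_pow[OF fermat_int[OF assms(2)]] fermat_int[OF assms(2)]]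
    by (simp add: power2_eq_square flip: power_mult)
  have "ring_cong K (int p) (of_int 2 * ?\<alpha> ^ p\<^sup>2) (of_int (2 ^ p\<^sup>2) * ?\<alpha> ^ p\<^sup>2)"
    by (intro ring_cong_mult ring_cong_of_int cong_sym[OF two]) auto
  also have "of_int (2 ^ p\<^sup>2) * ?\<alpha> ^ p\<^sup>2 = ((of_int K + of_int 1 * s) ^ p) ^ p"
    unfolding a2 power_mult[symmetric] by (simp add: power_mult_distrib power2_eq_square)
  also have "ring_cong K (int p) \<dots> ((of_int K + of_int (1 * e) * s) ^ p)"
    using s by (intro ring_cong_power frob) auto
  also have "ring_cong K (int p) \<dots> (of_int K + of_int ((1 * e) * e) * s)"
    by (rule frob)
  also have "ring_cong K (int p) \<dots> (of_int K + of_int 1 * s)"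
    using s ee by (intro ring_cong_add ring_cong_mult ring_cong_of_int) auto
  also have "of_int K + of_int 1 * s = of_int 2 * ?\<alpha>"
    using a2 by simp
  finally have double: "ring_cong K (int p) (of_int 2 * ?\<alpha> ^ p\<^sup>2) (of_int 2 * ?\<alpha>)" .
  have "coprime 2 (int p)"
    using \<open>odd p\<close> by simp
  then have "ring_cong K (int p) (?\<alpha> ^ p\<^sup>2) ?\<alpha>"
    by (intro ring_cong_cancel[OF _ _ _ double] kfib_ring_power kfib_ring_root)
  \<comment> \<open>Multiplying by \<alpha> - K, the inverse of \<alpha>, lowers the exponent by
    one.\<close>
  then have "ring_cong K (int p) ((?\<alpha> - of_int K) * ?\<alpha> ^ p\<^sup>2) ((?\<alpha> - of_int K) * ?\<alpha>)"
    by (intro ring_cong_scale kfib_ring_diff kfib_ring_root kfib_ring_of_int)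
  moreover have "(?\<alpha> - of_int K) * ?\<alpha> = 1"
    using kfib_root_square[of K] by (simp add: algebra_simps)
  moreover have "?\<alpha> ^ p\<^sup>2 = ?\<alpha> * ?\<alpha> ^ (p\<^sup>2 - 1)"
    using prime_gt_0_nat[OF assms(2)] by (simp add: power_eq_if)
  ultimately have "ring_cong K (int p) (?\<alpha> ^ (p\<^sup>2 - 1)) 1"
    by (simp flip: mult.assoc)
  then show ?thesis
    using assms(1) by (simp add: is_kfib_period_iff_root)
qed

text \<open>Modulo \<open>p\<close> the square root disappears after one Frobenius step, so 2
  \<alpha> ^ p \<equiv> K. Squaring gives 4 \<alpha> ^ (2 p) \<equiv> K^2 \<equiv> -4, so \<alpha> ^
  (2 p) \<equiv> -1.\<close>

lemma is_kfib_period_discriminant_prime: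
  assumes "K \<ge> 1" "prime p" "odd p" "int p dvd K\<^sup>2 + 4"
  shows "is_kfib_period K (int p) (4 * p)"
proof -
  let ?\<alpha> = "kfib_root K"
  define e where "e = (K\<^sup>2 + 4) ^ (p div 2)"
  define s where "s = sqrt (of_int (K\<^sup>2 + 4))"
  have s: "s \<in> kfib_ring K"
    unfolding s_def by blast
  have "p div 2 > 0"
    using \<open>odd p\<close> prime_gt_1_nat[OF assms(2)] by presburger
  then have e: "[e = 0] (mod int p)"
    unfolding e_def cong_0_iff using assms(4) by (simp add: dvd_trans[OF _ dvd_power])
  have "ring_cong K (int p) (of_int 2 * ?\<alpha> ^ p) (of_int (2 ^ p) * ?\<alpha> ^ p)"
    by (intro ring_cong_mult ring_cong_of_int cong_sym[OF fermat_int] assms) auto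
  also have "of_int (2 ^ p) * ?\<alpha> ^ p = (of_int K + of_int 1 * s) ^ p"
    by (simp add: s_def kfib_root_double[symmetric] power_mult_distrib del: of_int_add)
  also have "ring_cong K (int p) \<dots> (of_int K + of_int (1 * e) * s)"
    unfolding s_def e_def by (rule kfib_ring_frobenius_sqrt) fact+
  also have "ring_cong K (int p) \<dots> (of_int K + of_int 0 * s)"
    using s e by (intro ring_cong_add ring_cong_mult ring_cong_of_int) auto
  finally have *: "ring_cong K (int p) (of_int 2 * ?\<alpha> ^ p) (of_int K)"
    by simp
  have "ring_cong K (int p) ((of_int 2 * ?\<alpha> ^ p) ^ 2) (of_int K ^ 2)"
    by (rule ring_cong_power[OF _ _ *]) auto
  also have "ring_cong K (int p) (of_int K ^ 2) (of_int (- 4))"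
    unfolding of_int_power[symmetric] using assms(4)
    by (intro ring_cong_of_int) (simp add: cong_iff_dvd_diff)
  finally have neg: "ring_cong K (int p) (of_int 4 * ?\<alpha> ^ (p * 2)) (of_int 4 * of_int (- 1))"
    by (simp add: power_mult_distrib flip: power_mult)
  have cop: "coprime 4 (int p)"
    using \<open>odd p\<close> coprime_power_left_iff[of 2 2 "int p"] by simp
  have "?\<alpha> ^ (p * 2) \<in> kfib_ring K"
    by (intro kfib_ring_power kfib_ring_root)
  then have "ring_cong K (int p) ((?\<alpha> ^ (p * 2)) ^ 2) (of_int (- 1) ^ 2)"
    by (intro ring_cong_power ring_cong_cancel[OF cop _ _ neg] kfib_ring_of_int)
  then show ?thesis
    using assms(1) by (simp add: is_kfib_period_iff_root mult.commute[of 4] flip: power_mult)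
qed

section \<open>Periods modulo composite numbers\<close>

lemma is_kfib_period_coprime_mult:
  assumes "is_kfib_period K a t" "is_kfib_period K b t" "coprime a b"
  shows "is_kfib_period K (a * b) t"
  using assms unfolding is_kfib_period_def by (auto intro: coprime_cong_mult)

lemma is_kfib_period_prod_primes:
  assumes "finite A" "\<And>p. p \<in> A \<Longrightarrow> prime p" "\<And>p. p \<in> A \<Longrightarrow> is_kfib_period K (int p) t"
  shows "is_kfib_period K (int (\<Prod>A)) t"
  using assms
proof (induction A rule: finite_induct)
  case empty
  then show ?case
    by (simp add: is_kfib_period_def)
next
  case (insert p A)
  have "coprime (int p) (int (\<Prod>A))"
    using insert unfolding coprime_int_iff by (intro prod_coprime_right primes_coprime) auto
  then show ?case
    using insert by (auto intro: is_kfib_period_coprime_mult)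
qed

text \<open>Adjoins the prime factors of \<open>k\<close> one at a time; each divides the current
  modulus, so lifting applies.\<close>

lemma is_kfib_period_extend:
  fixes R k :: nat
  assumes "K \<ge> 1" "is_kfib_period K (int R) t" "\<And>p. prime p \<Longrightarrow> p dvd k \<Longrightarrow> p dvd R"
  shows "is_kfib_period K (int (R * k)) (t * k)"
  using assms(3)
proof (induction k rule: prime_divisors_induct)
  case zero
  then show ?case
    by (simp add: is_kfib_period_def)
next
  case (unit k)
  then show ?case
    using assms(2) by simp
next
  case (factor p k)
  have "is_kfib_period K (int p * int (R * k)) (p * (t * k))"
    using factor assms(1) by (intro is_kfib_period_lift) (auto simp flip: of_nat_mult)
  then show ?case
    by (simp add: mult_ac)
qed

text \<open>For odd \<open>K\<close> this is a period modulo the prime \<open>p\<close>, in general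
  not the least one.\<close>

definition kfib_prime_period :: "int \<Rightarrow> nat \<Rightarrow> nat" where
  "kfib_prime_period K p = (if p = 2 then 3 else if int p dvd K\<^sup>2 + 4 then 4 * p else p\<^sup>2 - 1)"

lemma is_kfib_period_2:
  assumes "odd K"
  shows "is_kfib_period K 2 3"
  using assms by (auto simp: is_kfib_period_def numeral_eq_Suc cong_iff_dvd_diff)

lemma is_kfib_period_prime:
  assumes "K \<ge> 1" "odd K" "prime p"
  shows "is_kfib_period K (int p) (kfib_prime_period K p)"
proof (cases "p = 2")
  case True
  then show ?thesis
    using is_kfib_period_2[OF assms(2)] by (simp add: kfib_prime_period_def)
next
  case False
  then have "odd p"
    using assms(3) by (simp add: prime_odd_nat prime_ge_2_nat le_neq_implies_less)
  then show ?thesis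
    using False is_kfib_period_discriminant_prime[OF assms(1,3)]
      is_kfib_period_square_minus_1[OF assms(1,3)]
    by (simp add: kfib_prime_period_def)
qed

lemma kfib_prime_period_pos: "prime p \<Longrightarrow> kfib_prime_period K p > 0"
  using prime_ge_2_nat[of p] power_mono[of 2 p 2] by (auto simp: kfib_prime_period_def)

text \<open>The product serves as a common multiple of the prime periods.\<close>

lemma is_kfib_period_radical:
  assumes "K \<ge> 1" "odd K"
  shows "is_kfib_period K (int (\<Prod>(prime_factors M))) (\<Prod>p\<in>prime_factors M. kfib_prime_period K p)"
  using assms by (intro is_kfib_period_prod_primes)
    (auto intro: is_kfib_period_dvd[OF _ is_kfib_period_prime] dvd_prodI)

lemma prod_prime_factors_dvd:
  fixes M :: nat
  shows "\<Prod>(prime_factors M) dvd M"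
proof (cases "M = 0")
  case False
  have "\<Prod>(prime_factors M) dvd (\<Prod>p\<in>prime_factors M. p ^ multiplicity p M)"
    by (intro prod_dvd_prod) (auto simp: prime_factors_multiplicity)
  then show ?thesis
    using False by (simp add: prod_prime_factors)
qed simp

lemma dvd_prod_prime_factors:
  fixes M :: nat
  assumes "prime p" "p dvd M" "M > 0"
  shows "p dvd \<Prod>(prime_factors M)"
  using assms dvd_prodI[of "prime_factors M" p "\<lambda>p. p"] by (simp add: prime_factors_dvd)

text \<open>
  Without the existence of some period, the \<open>LEAST\<close> in the definition of the period would be a junk value.
\<close>

lemma kfib_period_is_period:
  fixes M :: nat
  assumes "K \<ge> 1" "odd K" "M > 0"
  shows "is_kfib_period K (int M) (kfib_period K (int M)) \<and> kfib_period K (int M) > 0"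
proof -
  define R where "R = \<Prod>(prime_factors M)"
  define t where "t = (\<Prod>p\<in>prime_factors M. kfib_prime_period K p)"
  obtain k where k: "M = R * k"
    using prod_prime_factors_dvd unfolding R_def by blast
  have "is_kfib_period K (int (R * k)) (t * k)"
  proof (rule is_kfib_period_extend[OF assms(1)])
    show "is_kfib_period K (int R) t"
      unfolding R_def t_def using assms by (intro is_kfib_period_radical)
    show "p dvd R" if "prime p" "p dvd k" for p
      unfolding R_def using that assms(3) by (intro dvd_prod_prime_factors) (simp_all add: k)
  qed
  moreover have "t * k > 0"
    using assms(3) k by (auto simp: t_def intro!: prod_pos kfib_prime_period_pos)
  ultimately have "\<exists>t. t > 0 \<and> is_kfib_period K (int M) t"
    unfolding k by blast
  from LeastI_ex[OF this] show ?thesis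
    unfolding kfib_period_def is_kfib_period_iff_shift by blast
qed

text \<open>With \<open>M = R * k\<close>, the lifted period \<open>t * k\<close> modulo
  \<open>M\<close> is a multiple of the least period \<open>M\<close>; then \<open>k\<close>
  cancels.\<close>

lemma dvd_of_kfib_period_eq:
  fixes M R :: nat
  assumes "K \<ge> 1" "odd K" "M > 0" "kfib_period K (int M) = M"
    and "is_kfib_period K (int R) t" "R dvd M" "\<And>p. prime p \<Longrightarrow> p dvd M \<Longrightarrow> p dvd R"
  shows "R dvd t"
proof -
  obtain k where k: "M = R * k"
    using assms(6) by blast
  have "is_kfib_period K (int (R * k)) (t * k)"
    using assms(1,5,7) by (intro is_kfib_period_extend) (auto simp: k)
  then have "M dvd t * k"
    using kfib_period_dvd[OF assms(1)] kfib_period_is_period[OF assms(1-3)] assms(4) k by metis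
  then show ?thesis
    using k assms(3) by simp
qed

section \<open>Forced divisors 2, 3 and 8 of periods\<close>

text \<open>The left side is the norm of \<alpha> ^ n, and \<alpha> has norm -1.\<close>

lemma kfib_cassini: "(kfib K (Suc n))\<^sup>2 - K * kfib K n * kfib K (Suc n) - (kfib K n)\<^sup>2 = (-1) ^ n"
proof (induction n)
  case (Suc n)
  have "(kfib K (Suc (Suc n)))\<^sup>2 - K * kfib K (Suc n) * kfib K (Suc (Suc n)) - (kfib K (Suc n))\<^sup>2
      = - ((kfib K (Suc n))\<^sup>2 - K * kfib K n * kfib K (Suc n) - (kfib K n)\<^sup>2)"
    by (simp add: power2_eq_square algebra_simps)
  then show ?case
    unfolding Suc by simp
qed simp

text \<open>Modulo \<open>m\<close>, the norm identity at a period \<open>t\<close> reads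
  \<open>(-1) ^ t = 1\<close>.\<close>

lemma even_of_is_kfib_period:
  assumes "is_kfib_period K m t" "m > 2"
  shows "even t"
proof (rule ccontr)
  assume "odd t"
  have "[(kfib K (Suc t))\<^sup>2 - K * kfib K t * kfib K (Suc t) - (kfib K t)\<^sup>2 = 1\<^sup>2 - K * 0 * 1 - 0\<^sup>2] (mod m)"
    using assms(1) unfolding is_kfib_period_def
    by (intro cong_diff cong_mult cong_pow cong_refl) auto
  then have "[-1 = 1] (mod m)"
    unfolding kfib_cassini using \<open>odd t\<close> by simp
  then have "m dvd 2"
    by (simp add: cong_iff_dvd_diff)
  then show False
    using assms(2) zdvd_imp_le by fastforce
qed

lemma kfib_cong:
  assumes "[K = L] (mod m)"
  shows "[kfib K n = kfib L n] (mod m)"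
  using assms by (induction K n rule: kfib.induct) (auto intro: cong_add cong_mult)

text \<open>Since 3 is a period, only the remainders 1 and 2 have to be excluded.\<close>

lemma dvd_of_is_kfib_period_2:
  assumes "K \<ge> 1" "odd K" "is_kfib_period K 2 t"
  shows "3 dvd t"
proof -
  have per: "is_kfib_period K 2 (t mod 3)"
    using assms by (intro is_kfib_period_mod is_kfib_period_2)
  have "\<not> is_kfib_period K 2 1" "\<not> is_kfib_period K 2 2"
    using assms(2) by (auto simp: is_kfib_period_def cong_iff_dvd_diff numeral_2_eq_2)
  moreover have "t mod 3 = 0 \<or> t mod 3 = 1 \<or> t mod 3 = 2"
    by linarith
  ultimately have "t mod 3 = 0"
    using per by metis
  then show ?thesis
    by (simp add: mod_eq_0_iff_dvd)
qed

text \<open>Only the remainder modulo 8 matters, and replacing \<open>K\<close> by 1 or -1 makes the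
  values to be checked explicit.\<close>

lemma dvd_of_is_kfib_period_3:
  assumes "K \<ge> 1" "[K = 1] (mod 3) \<or> [K = - 1] (mod 3)"
    and "is_kfib_period K 3 8" "is_kfib_period K 3 t"
  shows "8 dvd t"
proof -
  have per: "is_kfib_period K 3 (t mod 8)"
    using assms by (intro is_kfib_period_mod)
  obtain L where L: "L = 1 \<or> L = -1" "[K = L] (mod 3)"
    using assms(2) by blast
  define r where "r = t mod 8"
  have "[kfib L r = 0] (mod 3)" "[kfib L (Suc r) = 1] (mod 3)"
    using per kfib_cong[OF L(2)] unfolding is_kfib_period_def r_def
    by (meson cong_sym cong_trans)+
  moreover have "r < Suc (Suc (Suc (Suc (Suc (Suc (Suc (Suc 0)))))))"
    by (simp add: r_def)
  ultimately have "r = 0"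
    using L(1) by (auto simp: cong_def less_Suc_eq)
  then show ?thesis
    by (simp add: r_def mod_eq_0_iff_dvd)
qed

section \<open>Prime divisors of a fixed point\<close>

lemma prime_dvd_fixed_point:
  fixes M q :: nat
  assumes "K \<ge> 1" "odd K" "M > 0" "kfib_period K (int M) = M" "prime q" "q dvd M"
  shows "q = 2 \<or> q = 3 \<or> int q dvd K\<^sup>2 + 4"
proof (rule ccontr)
  \<comment> \<open>The largest exceptional prime \<open>r\<close> has to divide \<open>p\<^sup>2 - 1\<close> for an exceptional prime
    \<open>p \<le> r\<close> or for \<open>p = 3\<close>.\<close>
  define B where "B = {q \<in> prime_factors M. q \<noteq> 2 \<and> q \<noteq> 3 \<and> \<not> int q dvd K\<^sup>2 + 4}"
  assume "\<not> ?thesis"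
  then have "q \<in> B"
    using assms by (simp add: B_def prime_factors_dvd)
  moreover have fin: "finite B"
    by (simp add: B_def)
  ultimately have "Max B \<in> B"
    using Max_in by blast
  define r where "r = Max B"
  have r: "prime r" "r dvd M" "r \<noteq> 2" "r \<noteq> 3" "\<not> int r dvd K\<^sup>2 + 4"
    using \<open>Max B \<in> B\<close> by (auto simp: B_def r_def)
  have r_max: "p \<le> r" if "p \<in> B" for p
    using that fin by (simp add: r_def)
  \<comment> \<open>The radical divides \<open>M\<close> and has the same primes, so it divides each
    of its own periods.\<close>
  have "\<Prod>(prime_factors M) dvd (\<Prod>p\<in>prime_factors M. kfib_prime_period K p)"
    using assms by (intro dvd_of_kfib_period_eq[OF assms(1-4) is_kfib_period_radical])
      (auto intro: prod_prime_factors_dvd dvd_prod_prime_factors)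
  then have "r dvd (\<Prod>p\<in>prime_factors M. kfib_prime_period K p)"
    using dvd_prod_prime_factors[OF r(1,2) assms(3)] dvd_trans by blast
  then obtain p where p: "prime p" "p dvd M" "r dvd kfib_prime_period K p"
    using r(1) by (auto simp: prime_dvd_prod_iff)
  have not_two_power: "\<not> r dvd 2 ^ n" for n
    using r(1,3) prime_dvd_power primes_dvd_imp_eq two_is_prime_nat by blast
  have "\<not> r dvd 3"
    using r(1,4) primes_dvd_imp_eq[of r 3] by auto
  then have "p \<noteq> 2"
    using p(3) by (auto simp: kfib_prime_period_def)
  show False
  proof (cases "int p dvd K\<^sup>2 + 4")
    case True
    then have "r dvd 2 ^ 2 * p"
      using p(3) \<open>p \<noteq> 2\<close> by (simp add: kfib_prime_period_def)
    then have "r = p"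
      using r(1) p(1) not_two_power primes_dvd_imp_eq by (metis prime_dvd_mult_iff)
    then show False
      using True r(5) by blast
  next
    case False
    then have dvd: "r dvd p\<^sup>2 - 1"
      using p(3) \<open>p \<noteq> 2\<close> by (simp add: kfib_prime_period_def)
    \<comment> \<open>For \<open>p = 3\<close> the period 8 is a power of 2.\<close>
    then have "p \<noteq> 3"
      using not_two_power[of 3] by auto
    then have "p \<in> B"
      using False p \<open>p \<noteq> 2\<close> assms(3) by (simp add: B_def prime_factors_dvd)
    then have "p \<le> r"
      by (rule r_max)
    have odd: "odd r" "odd p"
      using r(1,3) p(1) \<open>p \<noteq> 2\<close> primes_dvd_imp_eq two_is_prime_nat by blast+
    have "p > 1"
      using p(1) prime_gt_1_nat by blast
    then have "p\<^sup>2 - 1 = (p - 1) * (p + 1)"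
      by (simp add: power2_eq_square algebra_simps)
    then have "r dvd p - 1 \<or> r dvd p + 1"
      using dvd r(1) by (metis prime_dvd_mult_iff)
    then show False
    proof
      assume "r dvd p - 1"
      then have "r \<le> p - 1"
        using \<open>p > 1\<close> by (intro dvd_imp_le) auto
      then show False
        using \<open>p \<le> r\<close> \<open>p > 1\<close> by simp
    next
      \<comment> \<open>Together with \<open>p \<le> r\<close> this leaves \<open>r = p + 1\<close>,
        excluded by parity, and \<open>r = p\<close>, which would make \<open>p\<close> divide
        1.\<close>
      assume *: "r dvd p + 1"
      then have "r \<le> p + 1"
        by (intro dvd_imp_le) auto
      moreover have "r \<noteq> p + 1"
        using odd by auto
      ultimately have "r = p"
        using \<open>p \<le> r\<close> by simp
      then show False
        using * \<open>p > 1\<close> dvd_add_right_iff[of p p 1] by simp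
    qed
  qed
qed

section \<open>Exponents of 2 and 3, and the remaining cofactor\<close>

theorem theorem3p2:
  fixes K m :: int
  assumes "K \<ge> 1"
    and "[K = 1] (mod 6) \<or> [K = - 1] (mod 6)"
    and "m > 1"
    and "int (kfib_period K m) = m"
  shows "\<exists>j :: int \<Rightarrow> nat. m = 24 * (\<Prod>p\<in>prime_factors (K\<^sup>2 + 4). p ^ j p)"
proof -
  define M where "M = kfib_period K m"
  have m: "m = int M" "M > 1"
    unfolding M_def using assms(3,4) by linarith+
  have fix_M: "kfib_period K (int M) = M"
    by (simp add: M_def assms(4))
  have K3: "[K = 1] (mod 3) \<or> [K = - 1] (mod 3)"
    using assms(2) cong_dvd_modulus[of K _ 6] by auto
  have "[K = 1] (mod 2) \<or> [K = - 1] (mod 2)"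
    using assms(2) cong_dvd_modulus[of K _ 6] by auto
  then have "odd K"
    by (auto simp: cong_iff_dvd_diff)
  then have D2: "odd (K\<^sup>2 + 4)"
    by simp
  have D3: "\<not> 3 dvd K\<^sup>2 + 4"
  proof -
    have "[K\<^sup>2 + 4 = 1 + 4] (mod 3)"
      using K3 cong_pow[of K 1 3 2] cong_pow[of K "- 1" 3 2] by (intro cong_add) auto
    then show ?thesis
      using cong_dvd_iff[of "K\<^sup>2 + 4" 5 3] by simp
  qed
  have per: "is_kfib_period K (int M) M"
    using kfib_period_is_period[OF assms(1) \<open>odd K\<close>, of M] m fix_M by simp
  have per2: "is_kfib_period K 2 3"
    by (rule is_kfib_period_2) fact
  have per3: "is_kfib_period K 3 8"
    using is_kfib_period_square_minus_1[OF assms(1), of 3] D3 by simp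

  \<comment> \<open>F_2 = K is odd, so 2 is not a period modulo 2; thus \<open>M > 2\<close>, as the
    norm argument requires.\<close>
  have "M \<noteq> 2"
    using per \<open>odd K\<close> by (auto simp: is_kfib_period_def cong_iff_dvd_diff numeral_eq_Suc)
  then have "even M"
    using even_of_is_kfib_period[OF per] m by simp
  then have "3 dvd M"
    using dvd_of_is_kfib_period_2[OF assms(1) \<open>odd K\<close> is_kfib_period_dvd_modulus[OF per]] by simp
  then have "8 dvd M"
    using dvd_of_is_kfib_period_3[OF assms(1) K3 per3 is_kfib_period_dvd_modulus[OF per]]
    by (metis int_dvd_int_iff of_nat_numeral)
  with \<open>3 dvd M\<close> have "24 dvd M"
    by presburger

  define A where "A = {p \<in> prime_factors M. int p dvd K\<^sup>2 + 4}"
  define d where "d = \<Prod>A"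
  \<comment> \<open>144 = 16 * 9 exceeds 24 by one factor 2 and one factor 3, so \<open>g\<close>
    detects whether 16 or 9 divides \<open>M\<close>, while 24 is still a period modulo 144.\<close>
  define g where "g = gcd M 144"
  have "finite A"
    by (simp add: A_def)
  have A: "prime p" "odd p" "p \<noteq> 3" "int p dvd K\<^sup>2 + 4" "p dvd d" if "p \<in> A" for p
  proof -
    show p: "prime p" "int p dvd K\<^sup>2 + 4"
      using that by (auto simp: A_def)
    show "odd p"
      using dvd_trans[OF _ p(2), of 2] D2 by auto
    show "p \<noteq> 3"
      using p(2) D3 by auto
    show "p dvd d"
      unfolding d_def using that \<open>finite A\<close> by (rule dvd_prodI[rotated])
  qed
  have primes: "p = 2 \<or> p = 3 \<or> int p dvd K\<^sup>2 + 4" if "prime p" "p dvd M" for p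
    using prime_dvd_fixed_point[OF assms(1) \<open>odd K\<close> _ fix_M that] m by simp
  have per_d: "is_kfib_period K (int d) (24 * d)"
    unfolding d_def
  proof (intro is_kfib_period_prod_primes \<open>finite A\<close>)
    fix p assume p: "p \<in> A"
    have "4 * p dvd 24 * d"
      using A(5)[OF p] by (intro mult_dvd_mono) auto
    then show "is_kfib_period K (int p) (24 * \<Prod>A)"
      using is_kfib_period_discriminant_prime[OF assms(1) A(1,2,4)[OF p]]
        is_kfib_period_dvd[OF assms(1)] by (simp add: d_def)
  qed (use A in auto)
  \<comment> \<open>Period 3 modulo 2 extends by the factor 8 to 24 modulo 16; period 8 modulo 3
    lifts to 24 modulo 9.\<close>
  have per16: "is_kfib_period K 16 24"
    using is_kfib_period_extend[of K 2 3 "2 ^ 3"] assms(1) per2 prime_dvd_power[of _ 2 3] by auto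
  have per9: "is_kfib_period K 9 24"
    using is_kfib_period_lift[OF assms(1) per3, of 3] by simp
  have "coprime ((2::int) ^ 4) (3 ^ 2)"
    by (simp only: coprime_power_left_iff coprime_power_right_iff) simp
  then have "coprime (16::int) 9"
    by simp
  then have "is_kfib_period K (16 * 9) 24"
    by (intro is_kfib_period_coprime_mult per16 per9)
  moreover have g_dvd: "int g dvd 144"
    unfolding g_def by (metis gcd_dvd2 int_dvd_int_iff of_nat_numeral)
  ultimately have "is_kfib_period K (int g) (24 * d)"
    using is_kfib_period_mult[OF assms(1) is_kfib_period_dvd_modulus[of K 144 24 "int g"]] g_dvd
    by simp
  moreover have "coprime 144 d"
    unfolding d_def
  proof (rule prod_coprime_right)
    fix p assume p: "p \<in> A"
    then have "coprime 2 p" "coprime 3 p"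
      using A[OF p] by (auto intro: primes_coprime)
    then have "coprime (2 ^ 4 * 3 ^ 2) p"
      by (simp only: coprime_mult_left_iff coprime_power_left_iff) simp
    then show "coprime 144 p"
      by simp
  qed
  then have cop: "coprime g d"
    unfolding g_def using coprime_divisors dvd_refl gcd_dvd2 by blast
  ultimately have per_gd: "is_kfib_period K (int (g * d)) (24 * d)"
    using per_d by (auto intro: is_kfib_period_coprime_mult)
  have "24 dvd g"
    using \<open>24 dvd M\<close> by (simp add: g_def)
  \<comment> \<open>\<open>g * d\<close> contains all primes of \<open>M\<close>: 2 and 3 through
    \<open>g\<close>, the others through \<open>d\<close>. Cancelling \<open>d\<close> then bounds
    \<open>g\<close>.\<close>
  have "g * d dvd 24 * d"
  proof (rule dvd_of_kfib_period_eq[OF assms(1) \<open>odd K\<close> _ fix_M per_gd])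
    have "d dvd \<Prod>(prime_factors M)"
      unfolding d_def A_def by (intro prod_dvd_prod_subset) auto
    then have "d dvd M"
      using prod_prime_factors_dvd dvd_trans by blast
    then show "g * d dvd M"
      using cop by (intro divides_mult) (auto simp: g_def)
    show "p dvd g * d" if "prime p" "p dvd M" for p
    proof -
      have "p dvd 24 \<or> p \<in> A"
        using primes[OF that] that m by (auto simp: A_def prime_factors_dvd)
      then show ?thesis
        using \<open>24 dvd g\<close> A(5) by (meson dvd_mult dvd_mult2 dvd_trans)
    qed
  qed (use m in simp)
  moreover have "d > 0"
    unfolding d_def using A(1) prime_gt_0_nat by (intro prod_pos) auto
  ultimately have "g dvd 24"
    by simp
  have "\<not> 16 dvd M"
  proof
    assume "16 dvd M"
    then have "16 dvd g" by (simp add: g_def)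
    then have "16 dvd (24::nat)" using \<open>g dvd 24\<close> dvd_trans by blast
    then show False by simp
  qed
  have "\<not> 9 dvd M"
  proof
    assume "9 dvd M"
    then have "9 dvd g" by (simp add: g_def)
    then have "9 dvd (24::nat)" using \<open>g dvd 24\<close> dvd_trans by blast
    then show False by simp
  qed

  obtain N where N: "M = 24 * N"
    using \<open>24 dvd M\<close> by blast
  \<comment> \<open>Another factor 2 or 3 in \<open>N\<close> would put 16 or 9 into
    \<open>M\<close>.\<close>
  have "odd N" "\<not> 3 dvd N"
    using \<open>\<not> 16 dvd M\<close> \<open>\<not> 9 dvd M\<close> unfolding N by presburger+
  have sub: "prime_factors (int N) \<subseteq> prime_factors (K\<^sup>2 + 4)"
  proof
    fix p assume p: "p \<in> prime_factors (int N)"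
    then have "prime p" "p dvd int N"
      by auto
    moreover obtain q where q: "p = int q"
      using \<open>prime p\<close> prime_ge_0_int zero_le_imp_eq_int by blast
    ultimately have "prime q" "q dvd N"
      by auto
    then have "int q dvd K\<^sup>2 + 4"
      using primes[of q] \<open>odd N\<close> \<open>\<not> 3 dvd N\<close> by (auto simp: N)
    moreover have "K\<^sup>2 + 4 \<noteq> 0"
      using D2 by fastforce
    ultimately show "p \<in> prime_factors (K\<^sup>2 + 4)"
      using \<open>prime p\<close> q by (simp add: prime_factors_dvd)
  qed
  have "int N = (\<Prod>p\<in>prime_factors (int N). p ^ multiplicity p (int N))"
    using m N by (simp add: prod_prime_factors)
  \<comment> \<open>Primes of \<open>K\<^sup>2 + 4\<close> that do not divide \<open>N\<close>
    receive exponent 0.\<close>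
  also have "\<dots> = (\<Prod>p\<in>prime_factors (K\<^sup>2 + 4). p ^ multiplicity p (int N))"
  proof (intro prod.mono_neutral_left sub ballI)
    fix p assume "p \<in> prime_factors (K\<^sup>2 + 4) - prime_factors (int N)"
    then have "multiplicity p (int N) = 0"
      by (auto simp: prime_factors_multiplicity)
    then show "p ^ multiplicity p (int N) = 1"
      by simp
  qed simp
  finally have "m = 24 * (\<Prod>p\<in>prime_factors (K\<^sup>2 + 4). p ^ multiplicity p (int N))"
    using m N by simp
  then show ?thesis
    by (rule exI[of _ "\<lambda>p. multiplicity p (int N)"])
qed

end
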